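(* Let $(S,+)$ be an abelian semigroup and let $\mathbb{F}$ be a nonempty subset of $\mathbb{N}$. (1) The family of $\mathbb{F}$-konvex subsets of $S$ is closed under the algebraic addition of sets and, for all $k\in\mathbb{N}$, under the multiplication by $k$ and under the operation $[k]$; that is, if $A,B\subseteq S$ are $\mathbb{F}$-konvex and $k\in\mathbb{N}$, then $A+B$, $kA$ and $[k]A$ are $\mathbb{F}$-konvex. (2) The family of $\mathbb{F}$-konvex sets is not closed under the operation $k^{-1}$ in general; that is, there exist an abelian semigroup $S$, a nonempty $\mathbb{F}\subseteq\mathbb{N}$, a $k\in\mathbb{N}$ and an $\mathbb{F}$-konvex set $A\subseteq S$ such that $k^{-1}A$ is not $\mathbb{F}$-konvex. (3) For all $k\in\mathbb{N}$, the family of $\mathbb{F}$-convex subsets of $S$ is closed under the operation $k^{-1}$; that is, if $A\subseteq S$ is $\mathbb{F}$-convex, then $k^{-1}A$ is $\mathbb{F}$-convex. (4) The family of $\mathbb{F}$-convex sets is not closed under the algebraic addition, under the multiplication by $k$, and under the operation $[k]$ in general; that is, for each of these three operations there exist an abelian semigroup $S$, a nonempty $\mathbb{F}\subseteq\mathbb{N}$, and $\mathbb{F}$-convex sets $A,B\subseteq S$ (respectively an $\mathbb{F}$-convex set $A\subseteq S$ and a $k\in\mathbb{N}$) such that $A+B$ (respectively $kA$, respectively $[k]A$) is not $\mathbb{F}$-convex.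
   Context: $\mathbb{N}$ denotes the set of positive integers, and an abelian semigroup is a set with a commutative associative operation $+$. For $n\in\mathbb{N}$ and $x\in S$, $nx:=x+\cdots+x$ ($n$ summands). For $A,B\subseteq S$ and $n\in\mathbb{N}$ put $A+B:=\{a+b\mid a\in A,\ b\in B\}$, $nA:=\{nx\mid x\in A\}$, $n^{-1}A:=\{x\in S\mid nx\in A\}$, $[n]A:=\{x_1+\cdots+x_n\mid x_1,\ldots,x_n\in A\}$. A set $A\subseteq S$ is $n$-convex if $n^{-1}([n]A)\subseteq A$, and $n$-konvex if $[n]A\subseteq nA$. For a nonempty $\mathbb{F}\subseteq\mathbb{N}$, $A$ is $\mathbb{F}$-convex (respectively $\mathbb{F}$-konvex) if it is $n$-convex (respectively $n$-konvex) for all $n\in\mathbb{F}$. *)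

theory Defs
  imports Main
begin

text \<open>
  A semigroup is given by its operation \<open>add\<close> on a whole type, so that being an abelian semigroup
  is the library predicate \<^const>\<open>abel_semigroup\<close>. A semigroup need not have a
  neutral element, hence sums are only meaningful for at least one summand:
  \<open>sg_sum add x n\<close> is \<open>x 1 + \<dots> + x n\<close> for \<open>n \<ge> 1\<close>, and it is left unspecified for \<open>n = 0\<close>.
\<close>

fun sg_sum :: "('a \<Rightarrow> 'a \<Rightarrow> 'a) \<Rightarrow> (nat \<Rightarrow> 'a) \<Rightarrow> nat \<Rightarrow> 'a" where
  "sg_sum add x 0 = undefined"
| "sg_sum add x (Suc 0) = x 1"
| "sg_sum add x (Suc (Suc n)) = add (sg_sum add x (Suc n)) (x (Suc (Suc n)))"

definition multiple :: "('a \<Rightarrow> 'a \<Rightarrow> 'a) \<Rightarrow> nat \<Rightarrow> 'a \<Rightarrow> 'a" where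
  "multiple add n x = sg_sum add (\<lambda>_. x) n"

definition sum_set :: "('a \<Rightarrow> 'a \<Rightarrow> 'a) \<Rightarrow> 'a set \<Rightarrow> 'a set \<Rightarrow> 'a set" where
  "sum_set add A B = {add a b | a b. a \<in> A \<and> b \<in> B}"

text \<open>The sets \<open>n A\<close>, \<open>n\<^sup>-\<^sup>1 A\<close> and \<open>[n] A\<close>, in this order.\<close>

definition mult_set :: "('a \<Rightarrow> 'a \<Rightarrow> 'a) \<Rightarrow> nat \<Rightarrow> 'a set \<Rightarrow> 'a set" where
  "mult_set add n A = {multiple add n x | x. x \<in> A}"

definition div_set :: "('a \<Rightarrow> 'a \<Rightarrow> 'a) \<Rightarrow> nat \<Rightarrow> 'a set \<Rightarrow> 'a set" where
  "div_set add n A = {x. multiple add n x \<in> A}"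

definition fold_sum_set :: "('a \<Rightarrow> 'a \<Rightarrow> 'a) \<Rightarrow> nat \<Rightarrow> 'a set \<Rightarrow> 'a set" where
  "fold_sum_set add n A = {sg_sum add x n | x. \<forall>i\<in>{1..n}. x i \<in> A}"

definition n_convex :: "('a \<Rightarrow> 'a \<Rightarrow> 'a) \<Rightarrow> nat \<Rightarrow> 'a set \<Rightarrow> bool" where
  "n_convex add n A \<longleftrightarrow> div_set add n (fold_sum_set add n A) \<subseteq> A"

definition n_konvex :: "('a \<Rightarrow> 'a \<Rightarrow> 'a) \<Rightarrow> nat \<Rightarrow> 'a set \<Rightarrow> bool" where
  "n_konvex add n A \<longleftrightarrow> fold_sum_set add n A \<subseteq> mult_set add n A"

definition F_convex :: "('a \<Rightarrow> 'a \<Rightarrow> 'a) \<Rightarrow> nat set \<Rightarrow> 'a set \<Rightarrow> bool" where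
  "F_convex add F A \<longleftrightarrow> (\<forall>n\<in>F. n_convex add n A)"

definition F_konvex :: "('a \<Rightarrow> 'a \<Rightarrow> 'a) \<Rightarrow> nat set \<Rightarrow> 'a set \<Rightarrow> bool" where
  "F_konvex add F A \<longleftrightarrow> (\<forall>n\<in>F. n_konvex add n A)"

definition index_set :: "nat set \<Rightarrow> bool" where
  "index_set F \<longleftrightarrow> F \<noteq> {} \<and> F \<subseteq> {1..}"

end

theory Submission
  imports Defs
begin

text \<open>
  The positive claims all rest on the fact that finite sums commute with each other. In
  particular the map \<open>x \<mapsto> n x\<close> is an endomorphism of an abelian semigroup, so it passes through
  sums and commutes with \<open>x \<mapsto> k x\<close>.

  Konvexity says that a sum of \<open>n\<close> elements of \<open>A\<close> can be rewritten as \<open>n c\<close> with \<open>c\<close> in \<open>A\<close>. A sum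
  of \<open>n\<close> elements of \<open>A + B\<close>, of \<open>k A\<close> or of \<open>[k] A\<close> is regrouped into one, or several, sums of
  \<open>n\<close> elements of \<open>A\<close> (and of \<open>B\<close>); after rewriting these, the factor \<open>n\<close> is pulled out in front
  (\<open>n_konvex_sum_set\<close>, \<open>n_konvex_mult_set\<close>, \<open>n_konvex_fold_sum_set\<close>). Convexity passes to
  \<open>k\<^sup>-\<^sup>1 A\<close> because multiplication by \<open>k\<close> turns an equation \<open>n x = x\<^sub>1 + \<dots> + x\<^sub>n\<close> into
  \<open>n (k x) = k x\<^sub>1 + \<dots> + k x\<^sub>n\<close> (\<open>n_convex_div_set\<close>).

  The negative claims come from the failure of cancellation by \<open>2\<close>, with index set \<open>{2}\<close>. In the
  integers modulo \<open>2\<close> every doubled element is \<open>0\<close>, so pulling the konvex set \<open>{0}\<close> back along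
  doubling gives the whole semigroup, in which \<open>0 + 1\<close> is not a double. For convexity, addition is
  truncated at \<open>3\<close>: the set \<open>{1}\<close> is convex because \<open>2 x = 2\<close> still forces \<open>x = 1\<close>, whereas
  \<open>{2}\<close> is not, because \<open>2 + 2\<close> has been truncated to \<open>3\<close>, which is also \<open>3 + 3\<close>. All three
  operations lead from \<open>{1}\<close> to \<open>{2}\<close>.
\<close>

section \<open>Finite sums in an abelian semigroup\<close>

lemma sg_sum_cong:
  assumes "\<And>i. i \<in> {1..n} \<Longrightarrow> x i = y i"
  shows "sg_sum add x n = sg_sum add y n"
  using assms by (induction add x n rule: sg_sum.induct) auto

context abel_semigroup
begin

lemma sg_sum_distrib:
  assumes "n \<ge> 1"
  shows "sg_sum f (\<lambda>i. f (x i) (y i)) n = f (sg_sum f x n) (sg_sum f y n)"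
  using assms
proof (induction n rule: nat_induct_at_least)
  case base
  show ?case by simp
next
  case (Suc n)
  then obtain m where "n = Suc m" by (cases n) auto
  with Suc.IH show ?case by (simp add: ac_simps)
qed

lemma sg_sum_swap:
  assumes "n \<ge> 1" "k \<ge> 1"
  shows "sg_sum f (\<lambda>i. sg_sum f (\<lambda>j. x i j) k) n = sg_sum f (\<lambda>j. sg_sum f (\<lambda>i. x i j) n) k"
  using assms(1)
proof (induction n rule: nat_induct_at_least)
  case base
  show ?case by simp
next
  case (Suc n)
  then obtain m where "n = Suc m" by (cases n) auto
  with Suc.IH show ?case by (simp add: sg_sum_distrib[OF assms(2)])
qed

lemma multiple_add:
  "n \<ge> 1 \<Longrightarrow> multiple f n (f x y) = f (multiple f n x) (multiple f n y)"
  unfolding multiple_def by (rule sg_sum_distrib)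

lemma multiple_sg_sum:
  "n \<ge> 1 \<Longrightarrow> k \<ge> 1 \<Longrightarrow> multiple f k (sg_sum f x n) = sg_sum f (\<lambda>i. multiple f k (x i)) n"
  unfolding multiple_def by (rule sg_sum_swap)

lemma multiple_commute:
  "n \<ge> 1 \<Longrightarrow> k \<ge> 1 \<Longrightarrow> multiple f k (multiple f n x) = multiple f n (multiple f k x)"
  unfolding multiple_def by (rule sg_sum_swap)

section \<open>Operations that preserve konvexity or convexity\<close>

lemma n_konvexD:
  assumes "n_konvex f n A" "\<And>i. i \<in> {1..n} \<Longrightarrow> x i \<in> A"
  obtains c where "c \<in> A" "sg_sum f x n = multiple f n c"
  using assms unfolding n_konvex_def fold_sum_set_def mult_set_def by blast

lemma n_konvexI:
  assumes "\<And>x. (\<And>i. i \<in> {1..n} \<Longrightarrow> x i \<in> A) \<Longrightarrow> \<exists>c\<in>A. sg_sum f x n = multiple f n c"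
  shows "n_konvex f n A"
  using assms unfolding n_konvex_def fold_sum_set_def mult_set_def by blast

lemma n_konvex_sum_set:
  assumes "n \<ge> 1" "n_konvex f n A" "n_konvex f n B"
  shows "n_konvex f n (sum_set f A B)"
proof (rule n_konvexI)
  fix x assume "\<And>i. i \<in> {1..n} \<Longrightarrow> x i \<in> sum_set f A B"
  then have "\<forall>i\<in>{1..n}. \<exists>a b. a \<in> A \<and> b \<in> B \<and> x i = f a b"
    unfolding sum_set_def by blast
  then obtain a b where
    ab: "\<And>i. i \<in> {1..n} \<Longrightarrow> a i \<in> A \<and> b i \<in> B \<and> x i = f (a i) (b i)"
    by metis
  obtain c where c: "c \<in> A" "sg_sum f a n = multiple f n c"
    using n_konvexD[OF assms(2), of a] ab by blast
  obtain d where d: "d \<in> B" "sg_sum f b n = multiple f n d"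
    using n_konvexD[OF assms(3), of b] ab by blast
  have "sg_sum f x n = sg_sum f (\<lambda>i. f (a i) (b i)) n"
    using ab by (intro sg_sum_cong) auto
  also have "\<dots> = multiple f n (f c d)"
    using assms(1) by (simp add: sg_sum_distrib multiple_add c d)
  finally show "\<exists>e\<in>sum_set f A B. sg_sum f x n = multiple f n e"
    using c d unfolding sum_set_def by blast
qed

lemma n_konvex_mult_set:
  assumes "n \<ge> 1" "k \<ge> 1" "n_konvex f n A"
  shows "n_konvex f n (mult_set f k A)"
proof (rule n_konvexI)
  fix x assume "\<And>i. i \<in> {1..n} \<Longrightarrow> x i \<in> mult_set f k A"
  then have "\<forall>i\<in>{1..n}. \<exists>a. a \<in> A \<and> x i = multiple f k a"
    unfolding mult_set_def by blast
  then obtain a where a: "\<And>i. i \<in> {1..n} \<Longrightarrow> a i \<in> A \<and> x i = multiple f k (a i)"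
    by metis
  obtain c where c: "c \<in> A" "sg_sum f a n = multiple f n c"
    using n_konvexD[OF assms(3), of a] a by blast
  have "sg_sum f x n = sg_sum f (\<lambda>i. multiple f k (a i)) n"
    using a by (intro sg_sum_cong) auto
  also have "\<dots> = multiple f k (multiple f n c)"
    using assms(1,2) by (simp add: multiple_sg_sum flip: c(2))
  also have "\<dots> = multiple f n (multiple f k c)"
    using assms(1,2) by (rule multiple_commute)
  finally show "\<exists>e\<in>mult_set f k A. sg_sum f x n = multiple f n e"
    using c unfolding mult_set_def by blast
qed

text \<open>
  The \<open>n\<close> summands, each a sum of \<open>k\<close> elements of \<open>A\<close>, form an \<open>n \<times> k\<close> array. Konvexity is applied
  to each of its \<open>k\<close> columns.
\<close>

lemma n_konvex_fold_sum_set: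
  assumes "n \<ge> 1" "k \<ge> 1" "n_konvex f n A"
  shows "n_konvex f n (fold_sum_set f k A)"
proof (rule n_konvexI)
  fix x assume "\<And>i. i \<in> {1..n} \<Longrightarrow> x i \<in> fold_sum_set f k A"
  then have "\<forall>i\<in>{1..n}. \<exists>a. (\<forall>j\<in>{1..k}. a j \<in> A) \<and> x i = sg_sum f a k"
    unfolding fold_sum_set_def by blast
  then obtain a where
    a: "\<And>i j. i \<in> {1..n} \<Longrightarrow> j \<in> {1..k} \<Longrightarrow> a i j \<in> A"
       "\<And>i. i \<in> {1..n} \<Longrightarrow> x i = sg_sum f (a i) k"
    by metis
  have "\<exists>c. c \<in> A \<and> sg_sum f (\<lambda>i. a i j) n = multiple f n c" if "j \<in> {1..k}" for j
    using n_konvexD[OF assms(3), of "\<lambda>i. a i j"] a(1) that by blast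
  then obtain c where
    c: "\<And>j. j \<in> {1..k} \<Longrightarrow> c j \<in> A \<and> sg_sum f (\<lambda>i. a i j) n = multiple f n (c j)"
    by metis
  have "sg_sum f x n = sg_sum f (\<lambda>i. sg_sum f (a i) k) n"
    using a(2) by (intro sg_sum_cong) auto
  also have "\<dots> = sg_sum f (\<lambda>j. sg_sum f (\<lambda>i. a i j) n) k"
    using assms(1,2) by (rule sg_sum_swap)
  also have "\<dots> = sg_sum f (\<lambda>j. multiple f n (c j)) k"
    using c by (intro sg_sum_cong) auto
  also have "\<dots> = multiple f n (sg_sum f c k)"
    using assms(1,2) by (simp add: multiple_sg_sum)
  finally show "\<exists>e\<in>fold_sum_set f k A. sg_sum f x n = multiple f n e"
    using c unfolding fold_sum_set_def by blast
qed

lemma n_convex_div_set: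
  assumes "n \<ge> 1" "k \<ge> 1" "n_convex f n A"
  shows "n_convex f n (div_set f k A)"
  unfolding n_convex_def
proof
  fix x assume "x \<in> div_set f n (fold_sum_set f n (div_set f k A))"
  then obtain y where y: "\<And>i. i \<in> {1..n} \<Longrightarrow> multiple f k (y i) \<in> A"
    and eq: "multiple f n x = sg_sum f y n"
    unfolding div_set_def fold_sum_set_def by blast
  have "multiple f n (multiple f k x) = multiple f k (multiple f n x)"
    using assms(1,2) by (intro multiple_commute)
  also have "\<dots> = sg_sum f (\<lambda>i. multiple f k (y i)) n"
    using assms(1,2) by (simp add: eq multiple_sg_sum)
  finally have "multiple f k x \<in> div_set f n (fold_sum_set f n A)"
    using y unfolding div_set_def fold_sum_set_def by blast
  then show "x \<in> div_set f k A"
    using assms(3) unfolding n_convex_def div_set_def by blast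
qed

end

section \<open>The counterexamples\<close>

lemma multiple_2: "multiple add 2 x = add x x"
  by (simp add: multiple_def numeral_2_eq_2)

lemma mult_set_2: "mult_set add 2 A = (\<lambda>x. add x x) ` A"
  by (auto simp: mult_set_def multiple_2)

lemma div_set_2: "div_set add 2 A = {x. add x x \<in> A}"
  by (simp add: div_set_def multiple_2)

lemma fold_sum_set_2: "fold_sum_set add 2 A = sum_set add A A"
proof
  show "fold_sum_set add 2 A \<subseteq> sum_set add A A"
    by (fastforce simp: fold_sum_set_def sum_set_def numeral_2_eq_2)
  show "sum_set add A A \<subseteq> fold_sum_set add 2 A"
  proof
    fix z assume "z \<in> sum_set add A A"
    then obtain a b where "a \<in> A" "b \<in> A" "z = add a b"
      unfolding sum_set_def by blast
    then have "z = sg_sum add (\<lambda>i. if i = 1 then a else b) 2"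
      and "\<forall>i\<in>{1..2::nat}. (if i = 1 then a else b) \<in> A"
      by (simp_all add: numeral_2_eq_2)
    then show "z \<in> fold_sum_set add 2 A"
      unfolding fold_sum_set_def by blast
  qed
qed

lemma sum_set_singleton: "sum_set add {a} {b} = {add a b}"
  by (simp add: sum_set_def)

lemma F_konvex_2: "F_konvex add {2} A \<longleftrightarrow> sum_set add A A \<subseteq> (\<lambda>x. add x x) ` A"
  by (simp add: F_konvex_def n_konvex_def fold_sum_set_2 mult_set_2)

lemma F_convex_2_singleton: "F_convex add {2} {a} \<longleftrightarrow> (\<forall>x. add x x = add a a \<longrightarrow> x = a)"
  by (auto simp: F_convex_def n_convex_def fold_sum_set_2 div_set_2 sum_set_singleton)

lemma index_set_2: "index_set {2}"
  by (simp add: index_set_def)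

text \<open>
  The integers modulo \<open>2\<close>, on the type of all naturals: every sum is reduced to \<open>0\<close> or \<open>1\<close>, and a
  number behaves in sums like its parity.
\<close>

abbreviation add_mod_2 :: "nat \<Rightarrow> nat \<Rightarrow> nat" where
  "add_mod_2 a b \<equiv> (a + b) mod 2"

lemma abel_semigroup_add_mod_2: "abel_semigroup add_mod_2"
  by unfold_locales (simp_all add: mod_simps ac_simps)

lemma F_konvex_not_closed_div_set:
  "F_konvex add_mod_2 {2} {0}" "\<not> F_konvex add_mod_2 {2} (div_set add_mod_2 2 {0})"
proof -
  show "F_konvex add_mod_2 {2} {0}"
    by (simp add: F_konvex_2 sum_set_singleton)
  have "div_set add_mod_2 2 {0} = UNIV"
    by (auto simp: div_set_2)
  moreover have "1 \<in> sum_set add_mod_2 UNIV UNIV"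
    unfolding sum_set_def by (intro CollectI exI[of _ 0] exI[of _ 1]) simp
  moreover have "1 \<notin> (\<lambda>x::nat. (x + x) mod 2) ` UNIV"
    by auto
  ultimately show "\<not> F_konvex add_mod_2 {2} (div_set add_mod_2 2 {0})"
    unfolding F_konvex_2 by auto
qed

abbreviation add_upto_3 :: "nat \<Rightarrow> nat \<Rightarrow> nat" where
  "add_upto_3 a b \<equiv> min (a + b) 3"

lemma abel_semigroup_add_upto_3: "abel_semigroup add_upto_3"
  by unfold_locales auto

lemma F_convex_add_upto_3:
  "F_convex add_upto_3 {2} {1}" "\<not> F_convex add_upto_3 {2} {2}"
proof -
  show "F_convex add_upto_3 {2} {1}"
    by (auto simp: F_convex_2_singleton min_def split: if_splits)
  show "\<not> F_convex add_upto_3 {2} {2}"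
    unfolding F_convex_2_singleton by (auto intro: exI[of _ 3])
qed

lemma operations_on_1_add_upto_3:
  "sum_set add_upto_3 {1} {1} = {2}" "mult_set add_upto_3 2 {1} = {2}"
  "fold_sum_set add_upto_3 2 {1} = {2}"
  by (simp_all add: sum_set_singleton mult_set_2 fold_sum_set_2)

section \<open>Closure properties of konvex and convex sets\<close>

theorem proposition3:
  fixes add :: "'a \<Rightarrow> 'a \<Rightarrow> 'a" and F :: "nat set"
  assumes "abel_semigroup add" and "index_set F"
  shows
    "((\<forall>A B. F_konvex add F A \<longrightarrow> F_konvex add F B \<longrightarrow> F_konvex add F (sum_set add A B))
      \<and> (\<forall>k\<ge>1. \<forall>A. F_konvex add F A \<longrightarrow> F_konvex add F (mult_set add k A))
      \<and> (\<forall>k\<ge>1. \<forall>A. F_konvex add F A \<longrightarrow> F_konvex add F (fold_sum_set add k A)))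
     \<and>
     (\<exists>(add' :: nat \<Rightarrow> nat \<Rightarrow> nat) G k A. abel_semigroup add' \<and> index_set G \<and> k \<ge> 1
        \<and> F_konvex add' G A \<and> \<not> F_konvex add' G (div_set add' k A))
     \<and>
     (\<forall>k\<ge>1. \<forall>A. F_convex add F A \<longrightarrow> F_convex add F (div_set add k A))
     \<and>
     ((\<exists>(add' :: nat \<Rightarrow> nat \<Rightarrow> nat) G A B. abel_semigroup add' \<and> index_set G
        \<and> F_convex add' G A \<and> F_convex add' G B \<and> \<not> F_convex add' G (sum_set add' A B))
      \<and> (\<exists>(add' :: nat \<Rightarrow> nat \<Rightarrow> nat) G k A. abel_semigroup add' \<and> index_set G \<and> k \<ge> 1
        \<and> F_convex add' G A \<and> \<not> F_convex add' G (mult_set add' k A))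
      \<and> (\<exists>(add' :: nat \<Rightarrow> nat \<Rightarrow> nat) G k A. abel_semigroup add' \<and> index_set G \<and> k \<ge> 1
        \<and> F_convex add' G A \<and> \<not> F_convex add' G (fold_sum_set add' k A)))"
proof -
  interpret abel_semigroup add by (rule assms(1))
  have F: "n \<ge> 1" if "n \<in> F" for n
    using assms(2) that unfolding index_set_def by auto
  have konvex_sum: "F_konvex add F (sum_set add A B)"
    if "F_konvex add F A" "F_konvex add F B" for A B
    using that F n_konvex_sum_set unfolding F_konvex_def by blast
  have konvex_mult: "F_konvex add F (mult_set add k A)"
    if "k \<ge> 1" "F_konvex add F A" for k A
    using that F n_konvex_mult_set unfolding F_konvex_def by blast
  have konvex_fold: "F_konvex add F (fold_sum_set add k A)"
    if "k \<ge> 1" "F_konvex add F A" for k A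
    using that F n_konvex_fold_sum_set unfolding F_konvex_def by blast
  have convex_div: "F_convex add F (div_set add k A)"
    if "k \<ge> 1" "F_convex add F A" for k A
    using that F n_convex_div_set unfolding F_convex_def by blast
  have two: "(2::nat) \<ge> 1" by simp
  have not_konvex_div: "\<exists>(add' :: nat \<Rightarrow> nat \<Rightarrow> nat) G k A. abel_semigroup add' \<and> index_set G
      \<and> k \<ge> 1 \<and> F_konvex add' G A \<and> \<not> F_konvex add' G (div_set add' k A)"
    using abel_semigroup_add_mod_2 index_set_2 two F_konvex_not_closed_div_set by blast
  note ex = abel_semigroup_add_upto_3 index_set_2 F_convex_add_upto_3(1)
  have not_convex_sum: "\<exists>(add' :: nat \<Rightarrow> nat \<Rightarrow> nat) G A B. abel_semigroup add' \<and> index_set G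
      \<and> F_convex add' G A \<and> F_convex add' G B \<and> \<not> F_convex add' G (sum_set add' A B)"
    using ex operations_on_1_add_upto_3(1) F_convex_add_upto_3(2) by metis
  have not_convex_mult: "\<exists>(add' :: nat \<Rightarrow> nat \<Rightarrow> nat) G k A. abel_semigroup add' \<and> index_set G
      \<and> k \<ge> 1 \<and> F_convex add' G A \<and> \<not> F_convex add' G (mult_set add' k A)"
    using ex two operations_on_1_add_upto_3(2) F_convex_add_upto_3(2) by metis
  have not_convex_fold: "\<exists>(add' :: nat \<Rightarrow> nat \<Rightarrow> nat) G k A. abel_semigroup add' \<and> index_set G
      \<and> k \<ge> 1 \<and> F_convex add' G A \<and> \<not> F_convex add' G (fold_sum_set add' k A)"
    using ex two operations_on_1_add_upto_3(3) F_convex_add_upto_3(2) by metis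
  show ?thesis
    by (intro conjI allI impI)
      (fact konvex_sum konvex_mult konvex_fold convex_div not_konvex_div
        not_convex_sum not_convex_mult not_convex_fold)+
qed

end
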